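(* Let $d,n \ge 1$ be integers and let $u_0,u_n \in [1,n] = \{1,\dots,n\}$. (1) For $n \ge 1$ and every $\alpha \in C(n(d-1),n)$, \[ \sum_{k=0}^n \; \sum_{\alpha_1 \in C(k(d-1),n)} \; \sum_{\nu \in I(\alpha-\alpha_1,\,n-k)} z(\mathrm{fern}_{d,n-k},(u_0,u_n;\nu))\, J_{k,\alpha_1} = 0. \] (2) For $n \ge 2$, fix a $(d-1)$-tuple $\beta$ of integers in $[1,n]$. For every $\alpha \in C(n(d-1),n)$ and $u_0 \ne u_n$, \[ \sum_{k=0}^{n-1} \; \sum_{\alpha_1 \in C(k(d-1),n)} \; \sum_{\substack{\nu \in I(\alpha-\alpha_1,\,n-k)\\ \nu(1)=\beta}} z(\mathrm{fern}_{d,n-k},(u_0,u_n;\nu))\, J_{k,\alpha_1} = 0. \] Both identities hold in $R = \mathbb{Q}[a_{i,j} : 1 \le i,j \le n]$.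
   Context: Fix integers $d,n \ge 1$. The $a_{i,j}$ ($1 \le i,j \le n$) and $t$ are indeterminates, and $R = \mathbb{Q}[a_{i,j} : 1 \le i,j \le n]$. Compositions: $C(m,n)$ is the set of $n$-tuples $\alpha = (\alpha(1),\dots,\alpha(n))$ of non-negative integers with sum $m$; $x^\alpha = \prod_{i=1}^n x_i^{\alpha(i)}$. Sums and differences of compositions are taken componentwise. Labelings: a $k$-level labeling is a $k$-tuple $\nu = (\nu(1),\dots,\nu(k))$ where each $\nu(i) = (\nu(i,1),\dots,\nu(i,d-1))$ is a $(d-1)$-tuple of elements of $[1,n]$ (for $k=0$ there is only the empty labeling). For $\alpha \in C(k(d-1),n)$, $I(\alpha,k)$ is the set of $k$-level labelings $\nu$ such that $\alpha(r) = \#\{(i,j) : \nu(i,j) = r\}$ for each $r \in [1,n]$. If $\alpha - \alpha_1$ has a negative component, $I(\alpha-\alpha_1,k)$ is empty. The elements $J_{k,\alpha} \in R$, for $0 \le k \le n$ and $\alpha \in C(k(d-1),n)$: let $D(f)$ be the differential of the map $f_i(x) = x_i - (t\sum_{j=1}^n a_{i,j}x_j)^d$, i.e. the $n \times n$ matrix \[ (D(f))_{i,j} = \delta_{i,j} - t\,d\,a_{i,j}\Bigl(t\sum_{r=1}^n a_{i,r}x_r\Bigr)^{d-1}. \] The $J_{k,\alpha}$ are defined by \[ \det(D(f)) = \sum_{k=0}^n d^k t^{dk} \sum_{\alpha \in C(k(d-1),n)} J_{k,\alpha}\, x^\alpha . \] The elements $z$: for $m \ge 0$, $u, v \in [1,n]$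 and an $m$-level labeling $\nu$, \[ z(\mathrm{fern}_{d,m},(u,v;\nu)) = \sum_{\lambda} \prod_{i=1}^{m} \Bigl( a_{\lambda(i-1),\lambda(i)} \prod_{j=1}^{d-1} a_{\lambda(i-1),\nu(i,j)} \Bigr) \in R, \] where the sum is over all tuples $\lambda = (\lambda(0),\dots,\lambda(m)) \in [1,n]^{m+1}$ with $\lambda(0)=u$ and $\lambda(m)=v$. In particular $z(\mathrm{fern}_{d,0},(u,v;\emptyset)) = \delta_{u,v}$. (This is the sum over labelings of the rooted tree $\mathrm{fern}_{d,m}$ with leftmost path $v_0,\dots,v_m$, where each $v_i$ with $0 \le i<m$ has $v_{i+1}$ and $d-1$ further leaf children labeled $\nu(i+1,1),\dots,\nu(i+1,d-1)$, $v_0$ is labeled $u$ and $v_m$ is labeled $v$, of the product over all parent-child edges of $a_{\text{parent label},\text{child label}}$.) *)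

theory Defs
  imports
    "HOL-Library.FuncSet"
    "HOL-Library.Poly_Mapping"
    "HOL-Computational_Algebra.Polynomial"
    "Jordan_Normal_Form.Determinant"
begin

text \<open>
  The multivariate polynomial ring over \<open>S\<close> in indeterminates indexed by \<open>'v\<close> is the monoid
  algebra \<open>('v \<Rightarrow>\<^sub>0 nat) \<Rightarrow>\<^sub>0 S\<close> of finitely supported coefficient functions on exponents.
  The index types below provide further indeterminates \<open>avar i j\<close>, \<open>xvar j\<close> with indices outside
  \<open>{1..n}\<close>; these never occur in the expressions considered, so identities stated here are
  identities in the polynomial subring on the indices \<open>1, \<dots>, n\<close>.
\<close>

type_synonym coeff_ring = "((nat \<times> nat) \<Rightarrow>\<^sub>0 nat) \<Rightarrow>\<^sub>0 rat"
type_synonym xt_ring = "((nat \<Rightarrow>\<^sub>0 nat) \<Rightarrow>\<^sub>0 coeff_ring) poly"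

definition avar :: "nat \<Rightarrow> nat \<Rightarrow> coeff_ring" where
  "avar i j = Poly_Mapping.single (Poly_Mapping.single (i, j) 1) 1"

definition const :: "coeff_ring \<Rightarrow> xt_ring" where
  "const c = [:Poly_Mapping.single 0 c:]"

definition xvar :: "nat \<Rightarrow> xt_ring" where
  "xvar j = [:Poly_Mapping.single (Poly_Mapping.single j 1) 1:]"

definition tvar :: xt_ring where
  "tvar = [:0, 1:]"

text \<open>An \<open>n\<close>-tuple \<open>\<alpha>\<close> of naturals is a finitely supported map vanishing outside \<open>{1..n}\<close>.\<close>

definition compositions :: "nat \<Rightarrow> nat \<Rightarrow> (nat \<Rightarrow>\<^sub>0 nat) set" where
  "compositions m n =
     {\<alpha>. Poly_Mapping.keys \<alpha> \<subseteq> {1..n} \<and> (\<Sum>i=1..n. Poly_Mapping.lookup \<alpha> i) = m}"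

definition xpow :: "nat \<Rightarrow> (nat \<Rightarrow>\<^sub>0 nat) \<Rightarrow> xt_ring" where
  "xpow n \<alpha> = (\<Prod>i=1..n. xvar i ^ Poly_Mapping.lookup \<alpha> i)"

definition labelings :: "nat \<Rightarrow> nat \<Rightarrow> nat \<Rightarrow> (nat \<Rightarrow> nat \<Rightarrow> nat) set" where
  "labelings d n k = {1..k} \<rightarrow>\<^sub>E ({1..d - 1} \<rightarrow>\<^sub>E {1..n})"

text \<open>
  The content \<open>\<gamma>\<close> is integer valued, so that it may be a difference of compositions; the set is
  empty as soon as \<open>\<gamma>\<close> has a negative component.
\<close>

definition labelings_of_content :: "nat \<Rightarrow> nat \<Rightarrow> (nat \<Rightarrow> int) \<Rightarrow> nat \<Rightarrow> (nat \<Rightarrow> nat \<Rightarrow> nat) set" where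
  "labelings_of_content d n \<gamma> k =
     {\<nu> \<in> labelings d n k. \<forall>r\<in>{1..n}.
        \<gamma> r = int (card {(i, j). i \<in> {1..k} \<and> j \<in> {1..d - 1} \<and> \<nu> i j = r})}"

definition comp_diff :: "(nat \<Rightarrow>\<^sub>0 nat) \<Rightarrow> (nat \<Rightarrow>\<^sub>0 nat) \<Rightarrow> nat \<Rightarrow> int" where
  "comp_diff \<alpha> \<beta> r = int (Poly_Mapping.lookup \<alpha> r) - int (Poly_Mapping.lookup \<beta> r)"

definition Df_entry :: "nat \<Rightarrow> nat \<Rightarrow> nat \<Rightarrow> nat \<Rightarrow> xt_ring" where
  "Df_entry d n i j = (if i = j then 1 else 0)
     - tvar * of_nat d * const (avar i j) * (tvar * (\<Sum>r=1..n. const (avar i r) * xvar r)) ^ (d - 1)"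

text \<open>Library matrices are indexed from \<open>0\<close>, hence the shift.\<close>

definition Df :: "nat \<Rightarrow> nat \<Rightarrow> xt_ring mat" where
  "Df d n = mat n n (\<lambda>(i, j). Df_entry d n (Suc i) (Suc j))"

text \<open>
  \<open>Jcoef d n k \<alpha>\<close> is \<open>1 / d^k\<close> times the coefficient of \<open>t^(d k) x^\<alpha>\<close> in \<open>det (Df d n)\<close>.
  That the \<open>Jcoef d n k \<alpha>\<close> satisfy the expansion of \<open>det (Df d n)\<close> which is used to introduce them,
  and are the only elements that do, is proved in \<open>det_Df_expansion\<close> and \<open>Jcoef_unique\<close> below.
\<close>

definition Jcoef :: "nat \<Rightarrow> nat \<Rightarrow> nat \<Rightarrow> (nat \<Rightarrow>\<^sub>0 nat) \<Rightarrow> coeff_ring" where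
  "Jcoef d n k \<alpha> = Poly_Mapping.single 0 (1 / of_nat d ^ k)
     * Poly_Mapping.lookup (poly.coeff (det (Df d n)) (d * k)) \<alpha>"

definition z_fern :: "nat \<Rightarrow> nat \<Rightarrow> nat \<Rightarrow> nat \<Rightarrow> nat \<Rightarrow> (nat \<Rightarrow> nat \<Rightarrow> nat) \<Rightarrow> coeff_ring" where
  "z_fern d n m u v \<nu> =
     (\<Sum>l | l \<in> {0..m} \<rightarrow>\<^sub>E {1..n} \<and> l 0 = u \<and> l m = v.
        \<Prod>i=1..m. avar (l (i - 1)) (l i) * (\<Prod>j=1..d - 1. avar (l (i - 1)) (\<nu> i j)))"


subsection \<open>The expansion characterising \<open>Jcoef\<close>\<close>

text \<open>All terms \<open>t^m x^\<beta>\<close> occurring in \<open>p\<close> have \<open>(m, \<beta>) \<in> S\<close>.\<close>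

definition supp_in :: "(nat \<times> (nat \<Rightarrow>\<^sub>0 nat)) set \<Rightarrow> xt_ring \<Rightarrow> bool" where
  "supp_in S p \<longleftrightarrow> (\<forall>m \<beta>. Poly_Mapping.lookup (poly.coeff p m) \<beta> \<noteq> 0 \<longrightarrow> (m, \<beta>) \<in> S)"

lemma supp_inD: "supp_in S p \<Longrightarrow> Poly_Mapping.lookup (poly.coeff p m) \<beta> \<noteq> 0 \<Longrightarrow> (m, \<beta>) \<in> S"
  by (simp add: supp_in_def)

lemma supp_in_mono: "supp_in S p \<Longrightarrow> S \<subseteq> T \<Longrightarrow> supp_in T p"
  unfolding supp_in_def by blast

lemma supp_in_0: "supp_in S 0"
  by (simp add: supp_in_def)

lemma supp_in_add: "supp_in S p \<Longrightarrow> supp_in S q \<Longrightarrow> supp_in S (p + q)"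
  unfolding supp_in_def by (auto simp: lookup_add) (metis add.right_neutral)

lemma supp_in_uminus: "supp_in S p \<Longrightarrow> supp_in S (- p)"
  unfolding supp_in_def by auto

lemma supp_in_diff: "supp_in S p \<Longrightarrow> supp_in S q \<Longrightarrow> supp_in S (p - q)"
  using supp_in_add[of S p "- q"] supp_in_uminus[of S q] by simp

lemma supp_in_sum: "(\<And>i. i \<in> A \<Longrightarrow> supp_in S (f i)) \<Longrightarrow> supp_in S (sum f A)"
  by (induction A rule: infinite_finite_induct) (auto intro: supp_in_0 supp_in_add)

lemma supp_in_mult:
  assumes p: "supp_in S p" and q: "supp_in T q"
    and U: "\<And>m \<beta> m' \<beta>'. (m, \<beta>) \<in> S \<Longrightarrow> (m', \<beta>') \<in> T \<Longrightarrow> (m + m', \<beta> + \<beta>') \<in> U"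
  shows "supp_in U (p * q)"
  unfolding supp_in_def
proof (intro allI impI)
  fix m \<beta> assume "Poly_Mapping.lookup (poly.coeff (p * q) m) \<beta> \<noteq> 0"
  then have "(\<Sum>i\<le>m. Poly_Mapping.lookup (poly.coeff p i * poly.coeff q (m - i)) \<beta>) \<noteq> 0"
    by (simp add: coeff_mult lookup_sum)
  then obtain i where i: "i \<le> m"
    "Poly_Mapping.lookup (poly.coeff p i * poly.coeff q (m - i)) \<beta> \<noteq> 0"
    by (metis (no_types, lifting) atMost_iff sum.neutral)
  then have "\<beta> \<in> Poly_Mapping.keys (poly.coeff p i * poly.coeff q (m - i))"
    by (simp add: in_keys_iff)
  then obtain b c where bc: "\<beta> = b + c" "b \<in> Poly_Mapping.keys (poly.coeff p i)"
    "c \<in> Poly_Mapping.keys (poly.coeff q (m - i))"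
    using keys_mult by blast
  then have "(i, b) \<in> S" "(m - i, c) \<in> T"
    using supp_inD[OF p] supp_inD[OF q] by (auto simp: in_keys_iff)
  from U[OF this] show "(m, \<beta>) \<in> U" using i bc by simp
qed

lemma zero_in_compositions: "0 \<in> compositions 0 n"
  by (simp add: compositions_def)

lemma add_in_compositions:
  "\<beta> \<in> compositions l n \<Longrightarrow> \<beta>' \<in> compositions l' n \<Longrightarrow> \<beta> + \<beta>' \<in> compositions (l + l') n"
  unfolding compositions_def using keys_add[of \<beta> \<beta>'] by (auto simp: lookup_add sum.distrib)

definition bideg :: "nat \<Rightarrow> nat \<Rightarrow> nat \<Rightarrow> xt_ring \<Rightarrow> bool" where
  "bideg n k l p \<longleftrightarrow> supp_in ({k} \<times> compositions l n) p"

lemma bideg_mult: "bideg n k l p \<Longrightarrow> bideg n k' l' q \<Longrightarrow> bideg n (k + k') (l + l') (p * q)"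
  unfolding bideg_def by (erule (1) supp_in_mult) (auto intro: add_in_compositions)

lemma bideg_const: "bideg n 0 0 (const c)"
  unfolding bideg_def supp_in_def const_def
  by (auto simp: coeff_pCons lookup_single when_def zero_in_compositions split: nat.splits if_splits)

lemma one_eq_const: "1 = const 1"
  by (simp add: const_def one_pCons)

lemma bideg_one: "bideg n 0 0 1"
  unfolding one_eq_const by (rule bideg_const)

lemma const_mult: "const c * const c' = const (c * c')"
  by (simp add: const_def mult_single mult.commute)

lemma const_add: "const c + const c' = const (c + c')"
  by (simp add: const_def single_add)

lemma of_nat_eq_const: "of_nat m = const (of_nat m)"
  by (induction m) (simp_all add: one_eq_const const_add, simp add: const_def)

lemma bideg_x: "r \<in> {1..n} \<Longrightarrow> bideg n 0 1 (xvar r)"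
  unfolding bideg_def supp_in_def xvar_def
  by (auto simp: coeff_pCons lookup_single when_def compositions_def split: nat.splits if_splits)

lemma bideg_t: "bideg n 1 0 tvar"
  unfolding bideg_def supp_in_def tvar_def
  by (auto simp: coeff_pCons lookup_one when_def zero_in_compositions split: nat.splits if_splits)

lemma bideg_power: "bideg n k l p \<Longrightarrow> bideg n (e * k) (e * l) (p ^ e)"
  by (induction e) (auto simp: bideg_one intro: bideg_mult)

definition graded :: "nat \<Rightarrow> nat \<Rightarrow> nat \<Rightarrow> xt_ring \<Rightarrow> bool" where
  "graded d n N p \<longleftrightarrow> supp_in {(d * k, \<beta>) | k \<beta>. k \<le> N \<and> \<beta> \<in> compositions (k * (d - 1)) n} p"

lemma graded_bideg: "bideg n (d * k) (k * (d - 1)) p \<Longrightarrow> k \<le> N \<Longrightarrow> graded d n N p"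
  unfolding graded_def bideg_def by (erule supp_in_mono) auto

lemma graded_mult: "graded d n N p \<Longrightarrow> graded d n M q \<Longrightarrow> graded d n (N + M) (p * q)"
  unfolding graded_def
proof (erule (1) supp_in_mult)
  fix m \<beta> m' \<beta>'
  assume "(m, \<beta>) \<in> {(d * k, \<beta>) | k \<beta>. k \<le> N \<and> \<beta> \<in> compositions (k * (d - 1)) n}"
    and "(m', \<beta>') \<in> {(d * k, \<beta>) | k \<beta>. k \<le> M \<and> \<beta> \<in> compositions (k * (d - 1)) n}"
  then obtain k k' where "m = d * k" "k \<le> N" "\<beta> \<in> compositions (k * (d - 1)) n"
    "m' = d * k'" "k' \<le> M" "\<beta>' \<in> compositions (k' * (d - 1)) n" by auto
  then have "m + m' = d * (k + k') \<and> k + k' \<le> N + M \<and>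
      \<beta> + \<beta>' \<in> compositions ((k + k') * (d - 1)) n"
    using add_in_compositions by (auto simp: distrib_left distrib_right)
  then show "(m + m', \<beta> + \<beta>') \<in>
      {(d * k, \<beta>) | k \<beta>. k \<le> N + M \<and> \<beta> \<in> compositions (k * (d - 1)) n}" by blast
qed

lemma graded_one: "graded d n 0 1"
  by (rule graded_bideg[of _ _ 0]) (simp_all add: bideg_one)

lemma graded_prod:
  "finite A \<Longrightarrow> (\<And>i. i \<in> A \<Longrightarrow> graded d n 1 (f i)) \<Longrightarrow> graded d n (card A) (prod f A)"
proof (induction A rule: finite_induct)
  case (insert i A)
  then have "graded d n (1 + card A) (f i * prod f A)" by (intro graded_mult) auto
  then show ?case using insert by simp
qed (simp add: graded_one)

lemma graded_Df_entry:
  assumes "d \<ge> 1" shows "graded d n 1 (Df_entry d n i j)"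
proof -
  let ?L = "\<Sum>r=1..n. const (avar i r) * xvar r"
  have "bideg n 0 1 ?L"
    using bideg_mult[OF bideg_const bideg_x]
    unfolding bideg_def by (intro supp_in_sum) (simp add: bideg_def)
  from bideg_power[OF bideg_mult[OF bideg_t this]]
  have "bideg n (d - 1) (d - 1) ((tvar * ?L) ^ (d - 1))" by simp
  from bideg_mult[OF bideg_mult[OF bideg_mult[OF bideg_t bideg_const] bideg_const] this]
  have "bideg n (d * 1) (1 * (d - 1)) (tvar * of_nat d * const (avar i j) * (tvar * ?L) ^ (d - 1))"
    using assms by (simp add: of_nat_eq_const)
  then have 1: "graded d n 1 (tvar * of_nat d * const (avar i j) * (tvar * ?L) ^ (d - 1))"
    by (rule graded_bideg) simp
  have 2: "graded d n 1 (if i = j then 1 else 0)"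
    using graded_bideg[of n d 0 1 1] by (simp add: bideg_one graded_def supp_in_0)
  show ?thesis using 1 2 unfolding Df_entry_def graded_def by (intro supp_in_diff)
qed

lemma graded_det_Df:
  assumes "d \<ge> 1" shows "graded d n n (det (Df d n))"
proof -
  have car: "Df d n \<in> carrier_mat n n" by (simp add: Df_def)
  have pr: "graded d n n (\<Prod>i = 0..<n. Df d n $$ (i, p i))" if "p permutes {0..<n}" for p
  proof -
    have "graded d n (card {0..<n}) (\<Prod>i = 0..<n. Df d n $$ (i, p i))"
      using that permutes_in_image[OF that] graded_Df_entry[OF assms]
      by (intro graded_prod) (auto simp: Df_def)
    then show ?thesis by simp
  qed
  show ?thesis unfolding det_def'[OF car] graded_def
  proof (intro supp_in_sum)
    fix p assume "p \<in> {p. p permutes {0..<n}}"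
    with pr[of p] show "supp_in {(d * k, \<beta>) |k \<beta>. k \<le> n \<and> \<beta> \<in> compositions (k * (d - 1)) n}
        (signof p * (\<Prod>i = 0..<n. Df d n $$ (i, p i)))"
      by (cases "evenperm p") (auto simp: sign_def graded_def supp_in_uminus)
  qed
qed

lemma xpow_eq:
  assumes "Poly_Mapping.keys \<alpha> \<subseteq> {1..n}"
  shows "xpow n \<alpha> = [:Poly_Mapping.single \<alpha> 1:]"
proof -
  have mult: "[:Poly_Mapping.single \<beta> 1:] * [:Poly_Mapping.single \<gamma> (1::coeff_ring):]
      = [:Poly_Mapping.single (\<beta> + \<gamma>) 1:]" for \<beta> \<gamma> :: "nat \<Rightarrow>\<^sub>0 nat"
    by (simp add: mult_single add.commute)
  have one: "(1 :: xt_ring) = [:Poly_Mapping.single 0 1:]" by (simp add: one_pCons)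
  have pow: "xvar i ^ e = [:Poly_Mapping.single (Poly_Mapping.single i e) 1:]" for i e
    by (induction e) (simp_all only: power_0 power_Suc one single_zero xvar_def mult
          flip: single_add, simp)
  have "(\<Prod>i\<in>A. xvar i ^ Poly_Mapping.lookup \<alpha> i)
      = [:Poly_Mapping.single (\<Sum>i\<in>A. Poly_Mapping.single i (Poly_Mapping.lookup \<alpha> i)) 1:]"
    if "finite A" for A
    using that
  proof (induction A rule: finite_induct)
    case empty
    show ?case by (simp only: prod.empty sum.empty one)
  next
    case (insert i A)
    then show ?case by (simp only: prod.insert sum.insert not_False_eq_True pow mult)
  qed
  moreover have "(\<Sum>i\<in>{1..n}. Poly_Mapping.single i (Poly_Mapping.lookup \<alpha> i)) = \<alpha>"
  proof (rule poly_mapping_eqI)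
    fix r
    have "Poly_Mapping.lookup \<alpha> r = 0" if "r \<notin> {1..n}"
      using that assms by (meson in_keys_iff subsetD)
    then show "Poly_Mapping.lookup
        (\<Sum>i\<in>{1..n}. Poly_Mapping.single i (Poly_Mapping.lookup \<alpha> i)) r = Poly_Mapping.lookup \<alpha> r"
      by (auto simp: lookup_sum lookup_single when_def sum.delta')
  qed
  ultimately show ?thesis by (simp add: xpow_def)
qed

lemma finite_compositions: "finite (compositions m n)"
proof -
  have "compositions m n \<subseteq> Poly_Mapping.lookup -` {f. (\<forall>i\<in>{1..n}. f i \<in> {0..m}) \<and> (\<forall>i. i \<notin> {1..n} \<longrightarrow> f i = 0)}"
  proof
    fix \<alpha> assume \<alpha>: "\<alpha> \<in> compositions m n"
    have "Poly_Mapping.lookup \<alpha> i \<le> m" if "i \<in> {1..n}" for i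
      using \<alpha> that member_le_sum[of i "{1..n}" "Poly_Mapping.lookup \<alpha>"]
      by (auto simp: compositions_def)
    moreover have "Poly_Mapping.lookup \<alpha> i = 0" if "i \<notin> {1..n}" for i
      using that \<alpha> unfolding compositions_def by (metis (mono_tags, lifting) in_keys_iff mem_Collect_eq subsetD)
    ultimately show "\<alpha> \<in> Poly_Mapping.lookup -` {f. (\<forall>i\<in>{1..n}. f i \<in> {0..m}) \<and> (\<forall>i. i \<notin> {1..n} \<longrightarrow> f i = 0)}"
      by auto
  qed
  moreover have "finite {f. (\<forall>i\<in>{1..n}. f i \<in> {0..m}) \<and> (\<forall>i. i \<notin> {1..n} \<longrightarrow> f i = (0::nat))}"
    by (rule finite_subset[OF _ finite_set_of_finite_funs[of "{1..n}" "{0..m}" 0]]) auto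
  ultimately show ?thesis
    by (meson finite_subset finite_vimageI injI lookup_inject)
qed

lemma t_power: "tvar ^ e * p = monom 1 e * p"
proof -
  have "tvar ^ e = monom 1 e"
    by (simp add: tvar_def monom_altdef)
  then show ?thesis by simp
qed

text \<open>The coefficients of a series of the shape used to introduce \<open>Jcoef\<close>.\<close>

lemma coeff_expansion:
  assumes d: "d \<ge> 1"
  shows "Poly_Mapping.lookup (poly.coeff (\<Sum>k=0..n. of_nat d ^ k * tvar ^ (d * k) *
            (\<Sum>\<alpha>\<in>compositions (k * (d - 1)) n. const (K k \<alpha>) * xpow n \<alpha>)) m) \<beta>
       = (\<Sum>k=0..n. if m = d * k \<and> \<beta> \<in> compositions (k * (d - 1)) n
            then of_nat d ^ k * K k \<beta> else 0)"
proof -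
  have pw: "of_nat d ^ k = const (of_nat d ^ k)" for k
    by (metis of_nat_eq_const of_nat_power)
  have "Poly_Mapping.lookup (poly.coeff (of_nat d ^ k * tvar ^ (d * k) *
            (\<Sum>\<alpha>\<in>compositions (k * (d - 1)) n. const (K k \<alpha>) * xpow n \<alpha>)) m) \<beta>
      = (if m = d * k \<and> \<beta> \<in> compositions (k * (d - 1)) n then of_nat d ^ k * K k \<beta> else 0)" for k
  proof -
    let ?C = "compositions (k * (d - 1)) n"
    have summand: "const (of_nat d ^ k) * (const (K k \<alpha>) * xpow n \<alpha>)
        = monom (Poly_Mapping.single \<alpha> (of_nat d ^ k * K k \<alpha>)) 0" if "\<alpha> \<in> ?C" for \<alpha>
    proof -
      have "xpow n \<alpha> = [:Poly_Mapping.single \<alpha> 1:]"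
        using that by (intro xpow_eq) (simp add: compositions_def)
      then show ?thesis by (simp add: const_def mult_single monom_0 mult.commute)
    qed
    have "of_nat d ^ k * tvar ^ (d * k) * (\<Sum>\<alpha>\<in>?C. const (K k \<alpha>) * xpow n \<alpha>)
        = tvar ^ (d * k) * (\<Sum>\<alpha>\<in>?C. const (of_nat d ^ k) * (const (K k \<alpha>) * xpow n \<alpha>))"
      unfolding pw sum_distrib_left[symmetric] by (simp only: mult_ac)
    also have "\<dots> = tvar ^ (d * k) *
        (\<Sum>\<alpha>\<in>?C. monom (Poly_Mapping.single \<alpha> (of_nat d ^ k * K k \<alpha>)) 0)"
      by (simp only: summand cong: sum.cong)
    also have "\<dots> = (\<Sum>\<alpha>\<in>?C. monom (Poly_Mapping.single \<alpha> (of_nat d ^ k * K k \<alpha>)) (d * k))"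
      by (simp add: t_power sum_distrib_left mult_monom)
    finally show ?thesis
      using finite_compositions[of "k * (d - 1)" n]
      by (auto simp: coeff_sum lookup_sum lookup_single when_def sum.delta intro!: sum.neutral)
  qed
  then show ?thesis by (simp add: coeff_sum lookup_sum)
qed

lemma of_nat_eq_single: "(of_nat d :: coeff_ring) ^ k = Poly_Mapping.single 0 (of_nat d ^ k)"
  by (metis of_nat_power single_of_nat)

lemma coeff_expansion':
  assumes d: "d \<ge> 1" and k: "k \<le> n" and \<beta>: "\<beta> \<in> compositions (k * (d - 1)) n"
  shows "Poly_Mapping.lookup (poly.coeff (\<Sum>k=0..n. of_nat d ^ k * tvar ^ (d * k) *
            (\<Sum>\<alpha>\<in>compositions (k * (d - 1)) n. const (K k \<alpha>) * xpow n \<alpha>)) (d * k)) \<beta>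
       = of_nat d ^ k * K k \<beta>"
proof -
  have "(\<Sum>l=0..n. if d * k = d * l \<and> \<beta> \<in> compositions (l * (d - 1)) n
            then of_nat d ^ l * K l \<beta> else 0)
      = (\<Sum>l=0..n. if l = k then of_nat d ^ k * K k \<beta> else 0)"
    using d \<beta> by (intro sum.cong) auto
  also have "\<dots> = of_nat d ^ k * K k \<beta>" using k by simp
  finally show ?thesis unfolding coeff_expansion[OF d] .
qed

theorem det_Df_expansion:
  assumes d: "d \<ge> 1"
  shows "det (Df d n) = (\<Sum>k=0..n. of_nat d ^ k * tvar ^ (d * k) *
           (\<Sum>\<alpha>\<in>compositions (k * (d - 1)) n. const (Jcoef d n k \<alpha>) * xpow n \<alpha>))"
    (is "_ = ?R")
proof (rule poly_eqI, rule poly_mapping_eqI)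
  fix m \<beta>
  show "Poly_Mapping.lookup (poly.coeff (det (Df d n)) m) \<beta> = Poly_Mapping.lookup (poly.coeff ?R m) \<beta>"
  proof (cases "\<exists>k\<le>n. m = d * k \<and> \<beta> \<in> compositions (k * (d - 1)) n")
    case True
    then obtain k where k: "k \<le> n" "m = d * k" "\<beta> \<in> compositions (k * (d - 1)) n" by blast
    have "(of_nat d ^ k * Jcoef d n k \<beta>) = Poly_Mapping.lookup (poly.coeff (det (Df d n)) m) \<beta>"
      using d by (simp add: Jcoef_def k of_nat_eq_single mult_single flip: mult.assoc)
    then show ?thesis using coeff_expansion'[OF d k(1,3), of "Jcoef d n"] k(2) by simp
  next
    case False
    have "Poly_Mapping.lookup (poly.coeff (det (Df d n)) m) \<beta> = 0"
      using False graded_det_Df[OF d, of n] unfolding graded_def supp_in_def by blast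
    moreover have "Poly_Mapping.lookup (poly.coeff ?R m) \<beta> = 0"
      unfolding coeff_expansion[OF d] using False by (intro sum.neutral) auto
    ultimately show ?thesis by simp
  qed
qed

theorem Jcoef_unique:
  assumes d: "d \<ge> 1"
    and K: "det (Df d n) = (\<Sum>k=0..n. of_nat d ^ k * tvar ^ (d * k) *
           (\<Sum>\<alpha>\<in>compositions (k * (d - 1)) n. const (K k \<alpha>) * xpow n \<alpha>))"
    and k: "k \<le> n" and \<alpha>: "\<alpha> \<in> compositions (k * (d - 1)) n"
  shows "K k \<alpha> = Jcoef d n k \<alpha>"
proof -
  have "Jcoef d n k \<alpha> = Poly_Mapping.single 0 (1 / of_nat d ^ k) * (of_nat d ^ k * K k \<alpha>)"
    unfolding Jcoef_def K coeff_expansion'[OF d k \<alpha>] by simp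
  also have "\<dots> = K k \<alpha>"
    using d by (simp add: of_nat_eq_single mult_single flip: mult.assoc)
  finally show ?thesis by simp
qed

end

theory Submission
  imports Defs "HOL-Library.Product_Lexorder"
begin

text \<open>
  Let \<open>B\<close> be the matrix with entries \<open>a\<^sub>i\<^sub>j L\<^sub>i^(d - 1)\<close>, where \<open>L\<^sub>i\<close> is the sum of the
  \<open>a\<^sub>i\<^sub>r x\<^sub>r\<close>. Then \<open>D(f) = 1 - d t^d B\<close>, so the polynomials \<open>E\<^sub>k\<close> with coefficients
  \<open>J\<^sub>k\<^sub>,\<^sub>\<alpha>\<close> are the coefficients of the reversed characteristic polynomial of \<open>B\<close>, while the
  \<open>(u, v)\<close> entry of \<open>B^m\<close> is the generating function of the ferns \<open>z(fern\<^sub>d\<^sub>,\<^sub>m, (u, v; \<nu>))\<close> by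
  the content of \<open>\<nu>\<close>. Part (1) is a coefficient of the Cayley-Hamilton identity, the sum of the
  \<open>E\<^sub>k B^(n - k)\<close> being zero. For part (2) the term \<open>k = n\<close> is absent off the diagonal, and all
  remaining terms of row \<open>u\<^sub>0\<close> contain the factor \<open>L\<^sub>u\<^sub>0^(d - 1)\<close> of the first step; since the
  polynomial ring is a domain, it may be replaced by the single monomial of \<open>L\<^sub>u\<^sub>0^(d - 1)\<close>
  that belongs to \<open>\<beta>\<close>.

  The linear order on pairs is only there to make \<open>coeff_ring\<close>, whose variables are indexed by
  pairs, and the polynomial ring over it instances of the classes without zero divisors.
\<close>

section \<open>The Cayley-Hamilton theorem for the reversed characteristic polynomial\<close>

text \<open>
  The left-hand sum, cut off at \<open>K\<close> instead of \<open>n\<close>, telescopes to the coefficient of \<open>t^(d K)\<close> in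
  the adjugate of \<open>D\<close>, and that adjugate has degree less than \<open>d n\<close>.
\<close>

lemma reversed_Cayley_Hamilton:
  fixes B :: "'a :: comm_ring_1 mat"
  assumes B: "B \<in> carrier_mat n n" and d: "d \<ge> 1"
    and D: "D = mat n n (\<lambda>(i, j). (if i = j then 1 else 0) - monom (c * B $$ (i, j)) d)"
    and i: "i < n" and j: "j < n"
  shows "(\<Sum>k=0..n. coeff (det D) (d * k) * c ^ (n - k) * (B ^\<^sub>m (n - k)) $$ (i, j)) = 0"
proof -
  have carD: "D \<in> carrier_mat n n" by (simp add: D)
  note dimB [simp] = carrier_matD[OF B]
  define N where "N i j = adj_mat D $$ (i, j)" for i j
  \<comment> \<open>Entry \<open>(i, j)\<close> of adj(D) D = det(D) 1, solved for
    \<open>N i j\<close>: the identity part of \<open>D\<close> isolates it, and the rest carries a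
    factor t^d.\<close>
  have adjD: "N i j = (if i = j then det D else 0) + (\<Sum>q<n. N i q * monom (c * B $$ (q, j)) d)"
    if "i < n" "j < n" for i j
  proof -
    have "(adj_mat D * D) $$ (i, j) = (\<Sum>q<n. N i q * D $$ (q, j))"
      using that adj_mat(1)[OF carD] carD
      by (auto simp: times_mat_def scalar_prod_def N_def atLeast0LessThan intro!: sum.cong)
    also have "\<dots> = (\<Sum>q<n. (if q = j then N i q else 0) - N i q * monom (c * B $$ (q, j)) d)"
      using that by (intro sum.cong) (auto simp: D algebra_simps)
    also have "\<dots> = N i j - (\<Sum>q<n. N i q * monom (c * B $$ (q, j)) d)"
      using that by (simp add: sum_subtractf)
    finally show ?thesis
      unfolding adj_mat(3)[OF carD] using that by (cases "i = j") (simp_all add: algebra_simps)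
  qed
  have coeff_monom_mult_right: "coeff (p * monom b d) m = (if d \<le> m then coeff p (m - d) * b else 0)"
    for p :: "'a poly" and b m
    by (simp add: coeff_monom_mult mult.commute[of p] mult.commute[of b])
  \<comment> \<open>By \<open>adjD\<close>, passing from t^(d * K) to t^(d * Suc K) multiplies row
    \<open>i\<close> of \<open>N\<close> by \<open>c * B\<close> and adds a diagonal term, the
    summand \<open>k = Suc K\<close>. The whole row enters, hence the induction for all
    \<open>j\<close>.\<close>
  have telescope: "(\<Sum>k=0..K. coeff (det D) (d * k) * c ^ (K - k) * (B ^\<^sub>m (K - k)) $$ (i, j))
      = coeff (N i j) (d * K)" if "j < n" for K j
    using that
  proof (induction K arbitrary: j)
    case 0
    then show ?case
      using d i by (subst adjD) (auto simp: coeff_sum coeff_monom_mult_right)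
  next
    case (Suc K)
    have pow: "c ^ (Suc K - k) * (B ^\<^sub>m (Suc K - k)) $$ (i, j)
        = (\<Sum>q<n. c ^ (K - k) * (B ^\<^sub>m (K - k)) $$ (i, q) * (c * B $$ (q, j)))" if "k \<le> K" for k
    proof -
      have "(B ^\<^sub>m Suc (K - k)) $$ (i, j) = (\<Sum>q<n. (B ^\<^sub>m (K - k)) $$ (i, q) * B $$ (q, j))"
        using i Suc.prems
        by (simp add: times_mat_def scalar_prod_def pow_carrier_mat[OF B] atLeast0LessThan)
      then show ?thesis
        using that by (simp add: Suc_diff_le sum_distrib_left mult_ac)
    qed
    have "(\<Sum>k=0..Suc K. coeff (det D) (d * k) * c ^ (Suc K - k) * (B ^\<^sub>m (Suc K - k)) $$ (i, j))
        = (\<Sum>k=0..K. coeff (det D) (d * k) *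
             (\<Sum>q<n. c ^ (K - k) * (B ^\<^sub>m (K - k)) $$ (i, q) * (c * B $$ (q, j))))
          + (if i = j then coeff (det D) (d * Suc K) else 0)"
      using i Suc.prems by (simp add: pow mult.assoc)
    also have "(\<Sum>k=0..K. coeff (det D) (d * k) *
             (\<Sum>q<n. c ^ (K - k) * (B ^\<^sub>m (K - k)) $$ (i, q) * (c * B $$ (q, j))))
        = (\<Sum>q<n. (\<Sum>k=0..K. coeff (det D) (d * k) * c ^ (K - k) * (B ^\<^sub>m (K - k)) $$ (i, q))
             * (c * B $$ (q, j)))"
      unfolding sum_distrib_left sum_distrib_right
      by (subst sum.swap) (simp only: mult.assoc)
    also have "\<dots> = (\<Sum>q<n. coeff (N i q) (d * K) * (c * B $$ (q, j)))"
      by (simp add: Suc.IH)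
    also have "\<dots> + (if i = j then coeff (det D) (d * Suc K) else 0) = coeff (N i j) (d * Suc K)"
      using i Suc.prems by (subst adjD) (auto simp: coeff_sum coeff_monom_mult_right)
    finally show ?case .
  qed
  \<comment> \<open>\<open>N i j\<close> is up to sign a minor of size \<open>n - 1\<close>, so its
    degree stays below \<open>d * n\<close>, and \<open>telescope\<close> at \<open>K = n\<close>
    yields 0.\<close>
  have "degree (D $$ (i', j')) \<le> d" if "i' < n" "j' < n" for i' j'
    using that by (auto simp: D intro!: degree_diff_le degree_monom_le)
  then have "degree (det (mat_delete D j i)) \<le> d * (n - 1)"
    using carD by (intro degree_det_le) (auto simp: mat_delete_def)
  moreover have "N i j = (-1) ^ (j + i) * det (mat_delete D j i)"
    using i j carD by (simp add: N_def adj_mat_def cofactor_def)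
  then have "N i j = det (mat_delete D j i) \<or> N i j = - det (mat_delete D j i)"
    by (metis minus_one_power_iff mult_1 mult_minus1)
  ultimately have "degree (N i j) \<le> d * (n - 1)" by (metis degree_minus)
  also have "\<dots> < d * n" using d i by simp
  finally show ?thesis using telescope[OF j] by (simp add: coeff_eq_0)
qed

section \<open>Generating functions of ferns\<close>

lemma single_sum: "Poly_Mapping.single k (sum f A) = (\<Sum>a\<in>A. Poly_Mapping.single k (f a))"
  by (induction A rule: infinite_finite_induct) (simp_all add: single_add)

lemma prod_single:
  fixes c :: "'i \<Rightarrow> 'r :: comm_semiring_1"
  shows "(\<Prod>i\<in>A. Poly_Mapping.single (e i) (c i))
    = Poly_Mapping.single (\<Sum>i\<in>A. e i :: 'k :: comm_monoid_add) (\<Prod>i\<in>A. c i)"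
  by (induction A rule: infinite_finite_induct) (simp_all add: mult_single)

text \<open>Exponent of the monomial x_(b 1) ... x_(b (d - 1)): with contents encoded as exponents,
  they add up when generating functions are multiplied.\<close>

definition row_content :: "nat \<Rightarrow> (nat \<Rightarrow> nat) \<Rightarrow> nat \<Rightarrow>\<^sub>0 nat" where
  "row_content d b = (\<Sum>j=1..d - 1. Poly_Mapping.single (b j) 1)"

definition label_content :: "nat \<Rightarrow> nat \<Rightarrow> (nat \<Rightarrow> nat \<Rightarrow> nat) \<Rightarrow> nat \<Rightarrow>\<^sub>0 nat" where
  "label_content d m \<nu> = (\<Sum>i=1..m. row_content d (\<nu> i))"

text \<open>Generating function, by content, of the \<open>d - 1\<close> leaf children of a vertex
  labelled \<open>p\<close>. It lives in the polynomials in x alone, without t.\<close>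

definition leaf_sum ::
  "nat \<Rightarrow> (nat \<Rightarrow> nat) set \<Rightarrow> nat \<Rightarrow> (nat \<Rightarrow>\<^sub>0 nat) \<Rightarrow>\<^sub>0 coeff_ring" where
  "leaf_sum d B p = (\<Sum>b\<in>B. Poly_Mapping.single (row_content d b) (\<Prod>j=1..d - 1. avar p (b j)))"

definition fern_step ::
  "nat \<Rightarrow> (nat \<Rightarrow> nat) set \<Rightarrow> nat \<Rightarrow> nat \<Rightarrow> (nat \<Rightarrow>\<^sub>0 nat) \<Rightarrow>\<^sub>0 coeff_ring" where
  "fern_step d B p q = Poly_Mapping.single 0 (avar p q) * leaf_sum d B p"

text \<open>Allowing a different set \<open>S i\<close> of leaf labels on each level \<open>i\<close> covers both parts of the theorem.\<close>

definition fern_sum ::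
  "nat \<Rightarrow> nat \<Rightarrow> (nat \<Rightarrow> (nat \<Rightarrow> nat) set) \<Rightarrow> nat \<Rightarrow> nat \<Rightarrow> nat \<Rightarrow> (nat \<Rightarrow>\<^sub>0 nat) \<Rightarrow>\<^sub>0 coeff_ring" where
  "fern_sum d n S m u v =
     (\<Sum>\<nu>\<in>Pi\<^sub>E {1..m} S. Poly_Mapping.single (label_content d m \<nu>) (z_fern d n m u v \<nu>))"

text \<open>An entry of the product of the matrices \<open>w 1\<close>, ..., \<open>w m\<close>. The
  weight depends on the step because the admissible leaf labels may depend on the level.\<close>

definition walk_sum :: "'v set \<Rightarrow> (nat \<Rightarrow> 'v \<Rightarrow> 'v \<Rightarrow> 'r :: comm_semiring_1) \<Rightarrow> nat \<Rightarrow> 'v \<Rightarrow> 'v \<Rightarrow> 'r" where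
  "walk_sum V w m u v =
     (\<Sum>l | l \<in> {0..m} \<rightarrow>\<^sub>E V \<and> l 0 = u \<and> l m = v. \<Prod>i=1..m. w i (l (i - 1)) (l i))"

lemma walk_sum_0:
  assumes "u \<in> V"
  shows "walk_sum V w 0 u v = (if u = v then 1 else 0)"
proof (cases "u = v")
  case True
  have "{l. l \<in> {0..0::nat} \<rightarrow>\<^sub>E V \<and> l 0 = u \<and> l 0 = v} = {\<lambda>i\<in>{0}. u}"
    using True assms by (auto simp: PiE_iff extensional_def fun_eq_iff)
  then show ?thesis using True by (simp add: walk_sum_def)
next
  case False
  then have empty: "{l. l \<in> {0..0::nat} \<rightarrow>\<^sub>E V \<and> l 0 = u \<and> l 0 = v} = {}" by auto
  show ?thesis unfolding walk_sum_def empty using False by simp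
qed

text \<open>Walks are cut before their last step: \<open>q\<close> is the penultimate vertex, and
  \<open>restrict\<close> makes the remaining walk extensional again.\<close>

lemma walk_sum_Suc:
  assumes V: "finite V" and v: "v \<in> V"
  shows "walk_sum V w (Suc m) u v = (\<Sum>q\<in>V. walk_sum V w m u q * w (Suc m) q v)"
proof -
  let ?L = "\<lambda>q. {l. l \<in> {0..m} \<rightarrow>\<^sub>E V \<and> l 0 = u \<and> l m = q}"
  let ?P = "\<lambda>m l. \<Prod>i=1..m. w i (l (i - 1)) (l i)"
  have fin: "finite (?L q)" for q
    by (rule finite_subset[of _ "{0..m} \<rightarrow>\<^sub>E V"]) (auto intro: finite_PiE V)
  have "walk_sum V w (Suc m) u v
      = (\<Sum>(q, l)\<in>Sigma V ?L. ?P m l * w (Suc m) q v)"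
    unfolding walk_sum_def
  proof (rule sum.reindex_bij_witness[where j = "\<lambda>l. (l m, restrict l {0..m})"
        and i = "\<lambda>(q, l). l(Suc m := v)"])
    fix l assume l: "l \<in> {l. l \<in> {0..Suc m} \<rightarrow>\<^sub>E V \<and> l 0 = u \<and> l (Suc m) = v}"
    show "(case (l m, restrict l {0..m}) of (q, l) \<Rightarrow> l(Suc m := v)) = l"
      using l by (auto simp: fun_eq_iff PiE_iff extensional_def)
    show "(l m, restrict l {0..m}) \<in> Sigma V ?L" using l by auto
    have "?P m (restrict l {0..m}) = ?P m l" by (intro prod.cong) auto
    then show "(case (l m, restrict l {0..m}) of (q, l) \<Rightarrow> ?P m l * w (Suc m) q v) = ?P (Suc m) l"
      using l by simp
  next
    fix b assume "b \<in> Sigma V ?L"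
    then obtain q l where b: "b = (q, l)" and q: "q \<in> V" and l: "l \<in> {0..m} \<rightarrow>\<^sub>E V" "l 0 = u" "l m = q"
      by auto
    show "((case b of (q, l) \<Rightarrow> l(Suc m := v)) m, restrict (case b of (q, l) \<Rightarrow> l(Suc m := v)) {0..m}) = b"
      using l by (auto simp: b fun_eq_iff PiE_iff extensional_def)
    show "(case b of (q, l) \<Rightarrow> l(Suc m := v)) \<in> {l. l \<in> {0..Suc m} \<rightarrow>\<^sub>E V \<and> l 0 = u \<and> l (Suc m) = v}"
      using l v by (auto simp: b PiE_iff extensional_def le_Suc_eq)
  qed
  also have "\<dots> = (\<Sum>q\<in>V. \<Sum>l\<in>?L q. ?P m l * w (Suc m) q v)"
    using V fin by (simp add: sum.Sigma)
  finally show ?thesis by (simp add: walk_sum_def sum_distrib_right)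
qed

text \<open>Expanding the product over the levels chooses a row on each level, hence a labeling;
  exchanging this sum with the one over \<open>l\<close> collects \<open>z_fern\<close>.\<close>

lemma fern_sum_walk_sum:
  assumes "\<And>i. finite (S i)"
  shows "fern_sum d n S m u v = walk_sum {1..n} (\<lambda>i. fern_step d (S i)) m u v"
proof -
  let ?L = "{l. l \<in> {0..m} \<rightarrow>\<^sub>E {1..n} \<and> l 0 = u \<and> l m = v}"
  let ?s = "\<lambda>p q b. Poly_Mapping.single (row_content d b)
      (avar p q * (\<Prod>j=1..d - 1. avar p (b j)))"
  have step: "fern_step d B p q = (\<Sum>b\<in>B. ?s p q b)" for B p q
    by (simp add: fern_step_def leaf_sum_def sum_distrib_left mult_single)
  have "walk_sum {1..n} (\<lambda>i. fern_step d (S i)) m u v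
      = (\<Sum>l\<in>?L. \<Sum>\<nu>\<in>Pi\<^sub>E {1..m} S. \<Prod>i=1..m. ?s (l (i - 1)) (l i) (\<nu> i))"
    unfolding walk_sum_def step using assms by (subst prod_sum_PiE) auto
  also have "\<dots> = (\<Sum>\<nu>\<in>Pi\<^sub>E {1..m} S. \<Sum>l\<in>?L. \<Prod>i=1..m. ?s (l (i - 1)) (l i) (\<nu> i))"
    by (rule sum.swap)
  also have "\<dots> = fern_sum d n S m u v"
    unfolding fern_sum_def z_fern_def label_content_def single_sum prod_single ..
  finally show ?thesis ..
qed

context
  fixes d n :: nat and S :: "nat \<Rightarrow> (nat \<Rightarrow> nat) set"
  assumes fin: "\<And>i. finite (S i)"
begin

lemma fern_sum_0: "u \<in> {1..n} \<Longrightarrow> fern_sum d n S 0 u v = (if u = v then 1 else 0)"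
  by (simp add: fern_sum_walk_sum fin walk_sum_0)

lemma fern_sum_Suc:
  "v \<in> {1..n} \<Longrightarrow>
   fern_sum d n S (Suc m) u v = (\<Sum>q=1..n. fern_sum d n S m u q * fern_step d (S (Suc m)) q v)"
  by (simp add: fern_sum_walk_sum fin walk_sum_Suc)

lemma fern_sum_1:
  assumes "u \<in> {1..n}" "v \<in> {1..n}"
  shows "fern_sum d n S (Suc 0) u v = fern_step d (S (Suc 0)) u v"
proof -
  have "fern_sum d n S (Suc 0) u v = (\<Sum>q=1..n. if u = q then fern_step d (S (Suc 0)) q v else 0)"
    using assms fern_sum_Suc[of v 0 u] by (simp add: fern_sum_0 if_distrib[of "\<lambda>x. x * _"] cong: if_cong)
  then show ?thesis using assms by simp
qed

end

section \<open>Arbitrary leaf labels: powers of linear forms and of a matrix\<close>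

definition rows :: "nat \<Rightarrow> nat \<Rightarrow> (nat \<Rightarrow> nat) set" where
  "rows d n = {1..d - 1} \<rightarrow>\<^sub>E {1..n}"

definition linear_form :: "nat \<Rightarrow> nat \<Rightarrow> (nat \<Rightarrow>\<^sub>0 nat) \<Rightarrow>\<^sub>0 coeff_ring" where
  "linear_form n p = (\<Sum>r=1..n. Poly_Mapping.single (Poly_Mapping.single r 1) (avar p r))"

lemma finite_rows [simp]: "finite (rows d n)"
  by (simp add: rows_def finite_PiE)

text \<open>Expanding the power picks one variable in each of the \<open>d - 1\<close> factors, and
  these choices are exactly the rows.\<close>

lemma leaf_sum_rows: "leaf_sum d (rows d n) p = linear_form n p ^ (d - 1)"
proof -
  have "linear_form n p ^ (d - 1)
      = (\<Prod>j=1..d - 1. \<Sum>r\<in>{1..n}. Poly_Mapping.single (Poly_Mapping.single r 1) (avar p r))"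
    by (simp add: linear_form_def)
  also have "\<dots> = (\<Sum>b\<in>rows d n. \<Prod>j=1..d - 1. Poly_Mapping.single (Poly_Mapping.single (b j) 1) (avar p (b j)))"
    unfolding rows_def by (rule prod_sum_PiE) auto
  finally show ?thesis by (simp add: leaf_sum_def row_content_def prod_single)
qed

text \<open>The coefficient of x_u in the linear form is the indeterminate a_uu, and powers of
  nonzero elements of a domain are nonzero. This justifies the cancellation in part (2).\<close>

lemma leaf_sum_rows_nonzero:
  assumes "u \<in> {1..n}"
  shows "leaf_sum d (rows d n) u \<noteq> 0"
proof -
  have "Poly_Mapping.lookup (linear_form n u) (Poly_Mapping.single u 1)
      = (\<Sum>r=1..n. if r = u then avar u u else 0)"
    unfolding linear_form_def lookup_sum
    by (intro sum.cong) (auto simp: lookup_single when_def dest: arg_cong[where f = Poly_Mapping.keys])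
  also have "\<dots> = avar u u" using assms by simp
  finally have "Poly_Mapping.lookup (linear_form n u) (Poly_Mapping.single u 1) = avar u u" .
  moreover have "Poly_Mapping.lookup (avar u u) (Poly_Mapping.single (u, u) 1) = 1"
    by (simp add: avar_def)
  ultimately have "linear_form n u \<noteq> 0" by auto
  then show ?thesis by (simp add: leaf_sum_rows)
qed

text \<open>The matrix B of the opening remarks, by \<open>leaf_sum_rows\<close>, with indices
  shifted to start from 0.\<close>

definition fern_matrix :: "nat \<Rightarrow> nat \<Rightarrow> ((nat \<Rightarrow>\<^sub>0 nat) \<Rightarrow>\<^sub>0 coeff_ring) mat" where
  "fern_matrix d n = mat n n (\<lambda>(i, j). fern_step d (rows d n) (Suc i) (Suc j))"

lemma fern_matrix_carrier: "fern_matrix d n \<in> carrier_mat n n"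
  by (simp add: fern_matrix_def)

lemma fern_sum_rows:
  "i < n \<Longrightarrow> j < n \<Longrightarrow>
   fern_sum d n (\<lambda>_. rows d n) m (Suc i) (Suc j) = (fern_matrix d n ^\<^sub>m m) $$ (i, j)"
proof (induction m arbitrary: j)
  case 0
  then show ?case by (simp add: fern_sum_0 fern_matrix_def)
next
  case (Suc m)
  have "fern_sum d n (\<lambda>_. rows d n) (Suc m) (Suc i) (Suc j)
      = (\<Sum>q<n. fern_sum d n (\<lambda>_. rows d n) m (Suc i) (Suc q) * fern_step d (rows d n) (Suc q) (Suc j))"
    using Suc.prems by (subst fern_sum_Suc)
      (simp_all add: sum.atLeast1_atMost_eq)
  also have "\<dots> = (\<Sum>q<n. (fern_matrix d n ^\<^sub>m m) $$ (i, q) * fern_matrix d n $$ (q, j))"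
    using Suc.prems by (intro sum.cong) (simp_all add: Suc.IH, simp add: fern_matrix_def)
  also have "\<dots> = (fern_matrix d n ^\<^sub>m Suc m) $$ (i, j)"
    using Suc.prems fern_matrix_carrier[of d n]
    by (simp add: times_mat_def scalar_prod_def atLeast0LessThan)
  finally show ?case .
qed

text \<open>Every walk starts in \<open>u\<close>, so the row on level 1 contributes just a factor
  \<open>leaf_sum\<close> at \<open>u\<close>; cross-multiplication exchanges the two versions of it
  without division. The induction appends steps at the far end, so level 1 stays in the base
  case.\<close>

lemma fern_sum_fixed_first_row:
  assumes u: "u \<in> {1..n}" and v: "v \<in> {1..n}"
  shows "leaf_sum d (rows d n) u *
      fern_sum d n (\<lambda>i. if i = 1 then {\<beta>} else rows d n) (Suc m) u v
    = leaf_sum d {\<beta>} u * fern_sum d n (\<lambda>_. rows d n) (Suc m) u v"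
  using v
proof (induction m arbitrary: v)
  case 0
  then show ?case
    using u by (simp add: fern_sum_1 fern_step_def)
next
  case (Suc m)
  show ?case
    using Suc.prems
    by (subst (1 2) fern_sum_Suc)
      (auto simp: sum_distrib_left Suc.IH mult.assoc[symmetric] simp del: One_nat_def intro!: sum.cong)
qed

section \<open>The Jacobian determinant\<close>

definition J_sum :: "nat \<Rightarrow> nat \<Rightarrow> nat \<Rightarrow> (nat \<Rightarrow>\<^sub>0 nat) \<Rightarrow>\<^sub>0 coeff_ring" where
  "J_sum d n k = (\<Sum>\<alpha>\<in>compositions (k * (d - 1)) n. Poly_Mapping.single \<alpha> (Jcoef d n k \<alpha>))"

lemma lookup_of_nat_mult:
  fixes p :: "'k :: comm_monoid_add \<Rightarrow>\<^sub>0 'r :: comm_semiring_1"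
  shows "Poly_Mapping.lookup (of_nat m * p) x = of_nat m * Poly_Mapping.lookup p x"
  by (induction m) (simp_all add: lookup_add distrib_right)

lemma coeff_det_Df:
  assumes d: "d \<ge> 1" and k: "k \<le> n"
  shows "poly.coeff (det (Df d n)) (d * k) = of_nat d ^ k * J_sum d n k"
proof (rule poly_mapping_eqI)
  fix \<beta>
  \<comment> \<open>As \<open>d\<close> is positive, t^(d * k) arises only from the summand
    \<open>l = k\<close>.\<close>
  have "Poly_Mapping.lookup (poly.coeff (det (Df d n)) (d * k)) \<beta>
      = (\<Sum>l=0..n. if l = k \<and> \<beta> \<in> compositions (k * (d - 1)) n
          then of_nat d ^ k * Jcoef d n k \<beta> else 0)"
    unfolding det_Df_expansion[OF d] coeff_expansion[OF d] using d by (intro sum.cong) auto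
  also have "\<dots> = (if \<beta> \<in> compositions (k * (d - 1)) n then of_nat d ^ k * Jcoef d n k \<beta> else 0)"
    using k by auto
  also have "\<dots> = Poly_Mapping.lookup (of_nat (d ^ k) * J_sum d n k) \<beta>"
    unfolding lookup_of_nat_mult J_sum_def lookup_sum
    by (simp add: lookup_single when_def finite_compositions)
  finally show "Poly_Mapping.lookup (poly.coeff (det (Df d n)) (d * k)) \<beta>
      = Poly_Mapping.lookup (of_nat d ^ k * J_sum d n k) \<beta>"
    by simp
qed

text \<open>The t in front and the \<open>d - 1\<close> in the power combine to t^d. This is the
  shape that \<open>reversed_Cayley_Hamilton\<close> expects, with
  \<open>c = of_nat d\<close>.\<close>

lemma Df_fern_matrix:
  assumes d: "d \<ge> 1"
  shows "Df d n = mat n n (\<lambda>(i, j). (if i = j then 1 else 0)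
    - monom (of_nat d * fern_matrix d n $$ (i, j)) d)"
proof -
  have form: "(\<Sum>r=1..n. const (avar p r) * xvar r) = [:linear_form n p:]" for p
  proof -
    have "(\<Sum>r=1..n. const (avar p r) * xvar r)
        = (\<Sum>r=1..n. [:Poly_Mapping.single (Poly_Mapping.single r 1) (avar p r):])"
      by (intro sum.cong) (simp_all add: const_def xvar_def mult_single)
    then show ?thesis by (simp add: linear_form_def flip: monom_0 monom_sum)
  qed
  have entry: "tvar * of_nat d * const a * (tvar * [:L:]) ^ (d - 1)
      = monom (of_nat d * (Poly_Mapping.single 0 a * L ^ (d - 1))) d" for a L
  proof -
    have "tvar * of_nat d * const a * (tvar * [:L:]) ^ (d - 1)
        = tvar ^ Suc (d - 1) * (of_nat d * const a * [:L:] ^ (d - 1))"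
      by (simp only: power_mult_distrib power_Suc mult_ac)
    also have "\<dots> = monom 1 d * monom (of_nat d * (Poly_Mapping.single 0 a * L ^ (d - 1))) 0"
      using d t_power[of d 1] by (simp add: const_def of_nat_poly poly_const_pow monom_0 mult_ac)
    finally show ?thesis by (simp only: mult_monom) simp
  qed
  have "tvar * of_nat d * const a * (tvar * (\<Sum>r=1..n. const (avar p r) * xvar r)) ^ (d - 1)
      = monom (of_nat d * (Poly_Mapping.single 0 a * linear_form n p ^ (d - 1))) d" for a p
    unfolding form by (rule entry)
  then show ?thesis
    by (intro eq_matI)
      (simp_all add: Df_def Df_entry_def fern_matrix_def fern_step_def leaf_sum_rows)
qed

lemma sum_J_sum_fern_sum:
  assumes d: "d \<ge> 1" and u: "u \<in> {1..n}" and v: "v \<in> {1..n}"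
  shows "(\<Sum>k=0..n. J_sum d n k * fern_sum d n (\<lambda>_. rows d n) (n - k) u v) = 0" (is "?s = 0")
proof -
  obtain i j where ij: "u = Suc i" "v = Suc j" "i < n" "j < n"
    using u v by (metis Suc_le_eq atLeastAtMost_iff not0_implies_Suc not_one_le_zero)
  \<comment> \<open>The factor splits for each \<open>k\<close>: d^k is absorbed by the coefficient
    of the determinant, d^(n - k) is the power of \<open>c\<close>. It is cancelled at the end,
    being nonzero in a domain.\<close>
  have "of_nat d ^ n * ?s = (\<Sum>k=0..n. poly.coeff (det (Df d n)) (d * k) * of_nat d ^ (n - k)
      * (fern_matrix d n ^\<^sub>m (n - k)) $$ (i, j))"
    unfolding sum_distrib_left
  proof (rule sum.cong)
    fix k assume "k \<in> {0..n}"
    then have k: "k \<le> n" by simp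
    have "(of_nat d :: (nat \<Rightarrow>\<^sub>0 nat) \<Rightarrow>\<^sub>0 coeff_ring) ^ n = of_nat d ^ k * of_nat d ^ (n - k)"
      using k by (simp flip: power_add)
    then show "of_nat d ^ n * (J_sum d n k * fern_sum d n (\<lambda>_. rows d n) (n - k) u v)
        = poly.coeff (det (Df d n)) (d * k) * of_nat d ^ (n - k)
          * (fern_matrix d n ^\<^sub>m (n - k)) $$ (i, j)"
      using ij by (simp add: coeff_det_Df[OF d k] fern_sum_rows mult_ac)
  qed simp
  also have "\<dots> = 0"
    by (rule reversed_Cayley_Hamilton[OF fern_matrix_carrier d Df_fern_matrix[OF d] ij(3,4)])
  finally show ?thesis using d by simp
qed

section \<open>Extracting coefficients\<close>

lemma lookup_label_content:
  "Poly_Mapping.lookup (label_content d m \<nu>) r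
    = card {(i, j). i \<in> {1..m} \<and> j \<in> {1..d - 1} \<and> \<nu> i j = r}"
proof -
  have "Poly_Mapping.lookup (label_content d m \<nu>) r
      = (\<Sum>i=1..m. \<Sum>j=1..d - 1. if \<nu> i j = r then 1 else 0)"
    by (simp add: label_content_def row_content_def lookup_sum lookup_single when_def del: One_nat_def)
  also have "\<dots> = (\<Sum>(i, j)\<in>{1..m} \<times> {1..d - 1}. if \<nu> i j = r then 1 else 0)"
    by (rule sum.cartesian_product)
  also have "\<dots> = card {x \<in> {1..m} \<times> {1..d - 1}. case x of (i, j) \<Rightarrow> \<nu> i j = r}"
    by (subst card_eq_sum, subst sum.inter_filter) (auto intro!: sum.cong)
  also have "{x \<in> {1..m} \<times> {1..d - 1}. case x of (i, j) \<Rightarrow> \<nu> i j = r}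
      = {(i, j). i \<in> {1..m} \<and> j \<in> {1..d - 1} \<and> \<nu> i j = r}"
    by auto
  finally show ?thesis .
qed

text \<open>With \<open>\<alpha>\<^sub>1\<close> moved to the other side no negative component can
  arise: if the difference has one, both sets are empty. Outside \<open>{1..n}\<close> all three
  exponents vanish, so comparing on \<open>{1..n}\<close> suffices.\<close>

lemma labelings_of_content_comp_diff:
  assumes \<alpha>: "\<alpha> \<in> compositions M n" and \<alpha>\<^sub>1: "\<alpha>\<^sub>1 \<in> compositions N n"
  shows "labelings_of_content d n (comp_diff \<alpha> \<alpha>\<^sub>1) m
    = {\<nu> \<in> labelings d n m. \<alpha>\<^sub>1 + label_content d m \<nu> = \<alpha>}"
proof -
  have "(\<forall>r\<in>{1..n}. comp_diff \<alpha> \<alpha>\<^sub>1 r = int (card {(i, j). i \<in> {1..m} \<and> j \<in> {1..d - 1} \<and> \<nu> i j = r}))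
      \<longleftrightarrow> \<alpha>\<^sub>1 + label_content d m \<nu> = \<alpha>" if \<nu>: "\<nu> \<in> labelings d n m" for \<nu>
  proof -
    have outside: "Poly_Mapping.lookup \<alpha> r = 0" "Poly_Mapping.lookup \<alpha>\<^sub>1 r = 0"
      "Poly_Mapping.lookup (label_content d m \<nu>) r = 0" if "r \<notin> {1..n}" for r
    proof -
      show "Poly_Mapping.lookup \<alpha> r = 0" "Poly_Mapping.lookup \<alpha>\<^sub>1 r = 0"
        using \<alpha> \<alpha>\<^sub>1 that by (auto simp: compositions_def in_keys_iff)
      have "{(i, j). i \<in> {1..m} \<and> j \<in> {1..d - 1} \<and> \<nu> i j = r} = {}"
        using \<nu> that unfolding labelings_def by (auto simp: PiE_iff)
      then show "Poly_Mapping.lookup (label_content d m \<nu>) r = 0"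
        by (simp only: lookup_label_content card.empty)
    qed
    have "\<alpha>\<^sub>1 + label_content d m \<nu> = \<alpha> \<longleftrightarrow> (\<forall>r. Poly_Mapping.lookup \<alpha>\<^sub>1 r
        + Poly_Mapping.lookup (label_content d m \<nu>) r = Poly_Mapping.lookup \<alpha> r)"
      by (simp add: poly_mapping_eq_iff fun_eq_iff lookup_add)
    also have "\<dots> \<longleftrightarrow> (\<forall>r\<in>{1..n}. Poly_Mapping.lookup \<alpha>\<^sub>1 r
        + Poly_Mapping.lookup (label_content d m \<nu>) r = Poly_Mapping.lookup \<alpha> r)"
      by (metis outside add_0)
    also have "\<dots> \<longleftrightarrow> (\<forall>r\<in>{1..n}. comp_diff \<alpha> \<alpha>\<^sub>1 r = int (Poly_Mapping.lookup (label_content d m \<nu>) r))"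
      by (auto simp: comp_diff_def)
    finally show ?thesis unfolding lookup_label_content ..
  qed
  then show ?thesis unfolding labelings_of_content_def by blast
qed

text \<open>\<open>S\<close> and \<open>P\<close> express the same restriction, level by level and
  on whole labelings: \<open>P\<close> is trivial for part (1) and fixes \<open>\<nu> 1\<close> for
  part (2).\<close>

lemma lookup_J_sum_fern_sum:
  assumes \<alpha>: "\<alpha> \<in> compositions M n" and S: "\<And>i. finite (S i)"
    and T: "Pi\<^sub>E {1..m} S = {\<nu> \<in> labelings d n m. P \<nu>}"
  shows "Poly_Mapping.lookup (J_sum d n k * fern_sum d n S m u v) \<alpha>
    = (\<Sum>\<alpha>\<^sub>1\<in>compositions (k * (d - 1)) n.
        \<Sum>\<nu> | \<nu> \<in> labelings_of_content d n (comp_diff \<alpha> \<alpha>\<^sub>1) m \<and> P \<nu>.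
          z_fern d n m u v \<nu> * Jcoef d n k \<alpha>\<^sub>1)"
proof -
  have fin: "finite (Pi\<^sub>E {1..m} S)" using S by (simp add: finite_PiE)
  have "Poly_Mapping.lookup (J_sum d n k * fern_sum d n S m u v) \<alpha>
      = (\<Sum>\<alpha>\<^sub>1\<in>compositions (k * (d - 1)) n. \<Sum>\<nu>\<in>Pi\<^sub>E {1..m} S.
          if \<alpha>\<^sub>1 + label_content d m \<nu> = \<alpha> then z_fern d n m u v \<nu> * Jcoef d n k \<alpha>\<^sub>1 else 0)"
    by (simp add: J_sum_def fern_sum_def sum_product mult_single lookup_sum lookup_single when_def
        mult.commute cong: if_cong)
  also have "\<dots> = (\<Sum>\<alpha>\<^sub>1\<in>compositions (k * (d - 1)) n.
      \<Sum>\<nu> | \<nu> \<in> Pi\<^sub>E {1..m} S \<and> \<alpha>\<^sub>1 + label_content d m \<nu> = \<alpha>. z_fern d n m u v \<nu> * Jcoef d n k \<alpha>\<^sub>1)"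
    using fin by (simp add: sum.inter_filter)
  also have "\<dots> = (\<Sum>\<alpha>\<^sub>1\<in>compositions (k * (d - 1)) n.
        \<Sum>\<nu> | \<nu> \<in> labelings_of_content d n (comp_diff \<alpha> \<alpha>\<^sub>1) m \<and> P \<nu>.
          z_fern d n m u v \<nu> * Jcoef d n k \<alpha>\<^sub>1)"
    unfolding T by (intro sum.cong) (auto simp: labelings_of_content_comp_diff[OF \<alpha>])
  finally show ?thesis .
qed

theorem theorem1:
  fixes d n u\<^sub>0 u\<^sub>n :: nat
  assumes "d \<ge> 1" and "n \<ge> 1" and "u\<^sub>0 \<in> {1..n}" and "u\<^sub>n \<in> {1..n}"
  shows "(\<forall>\<alpha> \<in> compositions (n * (d - 1)) n.
            (\<Sum>k=0..n. \<Sum>\<alpha>\<^sub>1 \<in> compositions (k * (d - 1)) n.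
               \<Sum>\<nu> \<in> labelings_of_content d n (comp_diff \<alpha> \<alpha>\<^sub>1) (n - k).
                 z_fern d n (n - k) u\<^sub>0 u\<^sub>n \<nu> * Jcoef d n k \<alpha>\<^sub>1) = 0)
       \<and> (n \<ge> 2 \<longrightarrow> u\<^sub>0 \<noteq> u\<^sub>n \<longrightarrow>
           (\<forall>\<beta> \<in> {1..d - 1} \<rightarrow>\<^sub>E {1..n}. \<forall>\<alpha> \<in> compositions (n * (d - 1)) n.
            (\<Sum>k=0..n - 1. \<Sum>\<alpha>\<^sub>1 \<in> compositions (k * (d - 1)) n.
               \<Sum>\<nu> | \<nu> \<in> labelings_of_content d n (comp_diff \<alpha> \<alpha>\<^sub>1) (n - k) \<and> \<nu> 1 = \<beta>.
                 z_fern d n (n - k) u\<^sub>0 u\<^sub>n \<nu> * Jcoef d n k \<alpha>\<^sub>1) = 0))"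
proof (intro conjI impI ballI)
  note d = assms(1) and u\<^sub>0 = assms(3) and u\<^sub>n = assms(4)
  fix \<alpha> assume \<alpha>: "\<alpha> \<in> compositions (n * (d - 1)) n"
  have "(\<Sum>k=0..n. Poly_Mapping.lookup
      (J_sum d n k * fern_sum d n (\<lambda>_. rows d n) (n - k) u\<^sub>0 u\<^sub>n) \<alpha>) = 0"
    unfolding lookup_sum[symmetric] sum_J_sum_fern_sum[OF d u\<^sub>0 u\<^sub>n] by simp
  then show "(\<Sum>k=0..n. \<Sum>\<alpha>\<^sub>1 \<in> compositions (k * (d - 1)) n.
      \<Sum>\<nu> \<in> labelings_of_content d n (comp_diff \<alpha> \<alpha>\<^sub>1) (n - k).
        z_fern d n (n - k) u\<^sub>0 u\<^sub>n \<nu> * Jcoef d n k \<alpha>\<^sub>1) = 0"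
    by (subst (asm) lookup_J_sum_fern_sum[OF \<alpha>, where P = "\<lambda>_. True"])
      (simp_all add: labelings_def rows_def finite_PiE)
next
  note d = assms(1) and u\<^sub>0 = assms(3) and u\<^sub>n = assms(4)
  assume ne: "u\<^sub>0 \<noteq> u\<^sub>n"
  fix \<beta> \<alpha> assume \<beta>: "\<beta> \<in> {1..d - 1} \<rightarrow>\<^sub>E {1..n}" and \<alpha>: "\<alpha> \<in> compositions (n * (d - 1)) n"
  define S where "S = (\<lambda>i::nat. if i = 1 then {\<beta>} else rows d n)"
  have S: "finite (S i)" for i by (simp add: S_def)
  \<comment> \<open>Level 1 must exist for \<open>S\<close> to fix its row; this holds for
    \<open>m = n - k\<close> because the sum in part (2) stops at \<open>n - 1\<close>.\<close>
  have PiE_S: "Pi\<^sub>E {1..m} S = {\<nu> \<in> labelings d n m. \<nu> 1 = \<beta>}" if "m \<ge> 1" for m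
    using that \<beta> unfolding labelings_def S_def rows_def PiE_def Pi_def by auto
  have "leaf_sum d (rows d n) u\<^sub>0 * (\<Sum>k=0..n - 1. J_sum d n k * fern_sum d n S (n - k) u\<^sub>0 u\<^sub>n)
      = leaf_sum d {\<beta>} u\<^sub>0 *
        (\<Sum>k=0..n - 1. J_sum d n k * fern_sum d n (\<lambda>_. rows d n) (n - k) u\<^sub>0 u\<^sub>n)"
    unfolding sum_distrib_left
  proof (rule sum.cong)
    fix k assume "k \<in> {0..n - 1}"
    then have "n - k = Suc (n - k - 1)" using assms(2) by auto
    with fern_sum_fixed_first_row[OF u\<^sub>0 u\<^sub>n, of d \<beta> "n - k - 1"]
    have "leaf_sum d (rows d n) u\<^sub>0 * fern_sum d n S (n - k) u\<^sub>0 u\<^sub>n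
        = leaf_sum d {\<beta>} u\<^sub>0 * fern_sum d n (\<lambda>_. rows d n) (n - k) u\<^sub>0 u\<^sub>n"
      by (simp add: S_def)
    then show "leaf_sum d (rows d n) u\<^sub>0 * (J_sum d n k * fern_sum d n S (n - k) u\<^sub>0 u\<^sub>n)
        = leaf_sum d {\<beta>} u\<^sub>0 * (J_sum d n k * fern_sum d n (\<lambda>_. rows d n) (n - k) u\<^sub>0 u\<^sub>n)"
      by (simp add: mult.left_commute)
  qed simp
  also have "(\<Sum>k=0..n - 1. J_sum d n k * fern_sum d n (\<lambda>_. rows d n) (n - k) u\<^sub>0 u\<^sub>n)
      = (\<Sum>k=0..n. J_sum d n k * fern_sum d n (\<lambda>_. rows d n) (n - k) u\<^sub>0 u\<^sub>n)"
    using assms(2) u\<^sub>0 ne by (cases n) (simp_all add: fern_sum_0)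
  also have "\<dots> = 0" by (rule sum_J_sum_fern_sum[OF d u\<^sub>0 u\<^sub>n])
  finally have "(\<Sum>k=0..n - 1. J_sum d n k * fern_sum d n S (n - k) u\<^sub>0 u\<^sub>n) = 0"
    using leaf_sum_rows_nonzero[OF u\<^sub>0] by simp
  then have "(\<Sum>k=0..n - 1. Poly_Mapping.lookup (J_sum d n k * fern_sum d n S (n - k) u\<^sub>0 u\<^sub>n) \<alpha>) = 0"
    unfolding lookup_sum[symmetric] by simp
  moreover have "Poly_Mapping.lookup (J_sum d n k * fern_sum d n S (n - k) u\<^sub>0 u\<^sub>n) \<alpha>
      = (\<Sum>\<alpha>\<^sub>1\<in>compositions (k * (d - 1)) n.
        \<Sum>\<nu> | \<nu> \<in> labelings_of_content d n (comp_diff \<alpha> \<alpha>\<^sub>1) (n - k) \<and> \<nu> 1 = \<beta>.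
          z_fern d n (n - k) u\<^sub>0 u\<^sub>n \<nu> * Jcoef d n k \<alpha>\<^sub>1)" if "k \<in> {0..n - 1}" for k
    using that assms(2) by (intro lookup_J_sum_fern_sum[OF \<alpha> S] PiE_S) auto
  ultimately show "(\<Sum>k=0..n - 1. \<Sum>\<alpha>\<^sub>1 \<in> compositions (k * (d - 1)) n.
      \<Sum>\<nu> | \<nu> \<in> labelings_of_content d n (comp_diff \<alpha> \<alpha>\<^sub>1) (n - k) \<and> \<nu> 1 = \<beta>.
        z_fern d n (n - k) u\<^sub>0 u\<^sub>n \<nu> * Jcoef d n k \<alpha>\<^sub>1) = 0"
    by simp
qed

end
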